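(* Let $\mathscr{H}$ be a complex Hilbert space and let $T,S$ be bounded linear operators on $\mathscr{H}$ such that $|T|S=S^*|T|$. Let $f,g$ be nonnegative continuous functions on $[0,\infty)$ satisfying $f(t)g(t)=t$ for all $t\ge 0$. Then for all real $p\ge 2$, $$\begin{aligned}w(TS)&\le\frac12\Big(\|S\|+\|S^2\|^{1/2}\Big)\cdot\Big[\|f^p(|T|)\|^2-\ell\Big(\big|f^2(|T|)-\|f(|T|)\|^2 1_{\mathscr{H}}\big|^p\Big)\Big]^{\frac1{2p}}\\&\qquad\times\Big[\|g^p(|T^*|)\|^2-\ell\Big(\big|g^2(|T^*|)-\|g(|T^*|)\|^2 1_{\mathscr{H}}\big|^p\Big)\Big]^{\frac1{2p}}.\end{aligned}$$
   Context: $w(X)=\sup_{\|x\|=1}|\langle Xx,x\rangle|$ is the numerical radius, $\|\cdot\|$ the operator norm, and $\ell(X)=\inf\{\|Xx\|:x\in\mathscr{H},\|x\|=1\}$. $1_{\mathscr{H}}$ is the identity operator. For a bounded operator $X$, $|X|=(X^*X)^{1/2}$. Functions of positive operators are defined by the continuous functional calculus, and $f^{q}(|T|)$ means $(f(|T|))^{q}$. *)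

theory Defs
  imports "HOL-Analysis.Analysis" "HOL-Computational_Algebra.Polynomial"
begin

class complex_inner = real_inner +
  fixes scaleC :: "complex \<Rightarrow> 'a \<Rightarrow> 'a" (infixr "*\<^sub>C" 75)
    and cinner :: "'a \<Rightarrow> 'a \<Rightarrow> complex"
  assumes scaleC_add_right: "a *\<^sub>C (x + y) = a *\<^sub>C x + a *\<^sub>C y"
    and scaleC_add_left: "(a + b) *\<^sub>C x = a *\<^sub>C x + b *\<^sub>C x"
    and scaleC_scaleC: "a *\<^sub>C b *\<^sub>C x = (a * b) *\<^sub>C x"
    and scaleR_scaleC: "r *\<^sub>R x = complex_of_real r *\<^sub>C x"
    and cinner_add_left: "cinner (x + y) z = cinner x z + cinner y z"
    and cinner_scaleC_left: "cinner (a *\<^sub>C x) y = a * cinner x y"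
    and cinner_commute: "cinner x y = cnj (cinner y x)"
    and inner_eq_Re_cinner: "inner x y = Re (cinner x y)"

text \<open>
  The inner product is linear in its first argument. Positive definiteness, the norm and its
  topology come from \<^class>\<open>real_inner\<close>, whose real inner product is the real part of
  \<^const>\<open>cinner\<close>; conjugate symmetry makes \<^term>\<open>cinner x x\<close> real, so its square root is the norm.
\<close>

class chilbert_space = complex_inner + complete_space

text \<open>
  Bounded operators are elements of \<^typ>\<open>'a \<Rightarrow>\<^sub>L 'a\<close>, which are only real-linear, that
  satisfy the following predicate. The operator norm is \<^const>\<open>norm\<close> on that type.
\<close>

definition clinear_op :: "('a::complex_inner \<Rightarrow>\<^sub>L 'a) \<Rightarrow> bool" where
  "clinear_op X \<longleftrightarrow> (\<forall>c x. X (c *\<^sub>C x) = c *\<^sub>C X x)"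

definition adj :: "('a::chilbert_space \<Rightarrow>\<^sub>L 'a) \<Rightarrow> ('a \<Rightarrow>\<^sub>L 'a)" where
  "adj X = (THE Y :: 'a \<Rightarrow>\<^sub>L 'a. \<forall>x y. cinner (X x) y = cinner x (Y y))"

text \<open>
  The element 0 only matters on the zero space, where there are no unit vectors; it
  implements the convention that the supremum of an empty set of nonnegative numbers is 0.
\<close>

definition numerical_radius :: "('a::complex_inner \<Rightarrow>\<^sub>L 'a) \<Rightarrow> real" where
  "numerical_radius X = Sup (insert 0 {cmod (cinner (X x) x) | x. norm x = 1})"

definition ell :: "('a::complex_inner \<Rightarrow>\<^sub>L 'a) \<Rightarrow> real" where
  "ell X = Inf {norm (X x) | x. norm x = 1}"

definition spectrum :: "('a::complex_inner \<Rightarrow>\<^sub>L 'a) \<Rightarrow> complex set" where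
  "spectrum X = {z. \<not> (\<exists>Y :: 'a \<Rightarrow>\<^sub>L 'a.
     (\<forall>x. Y (X x - z *\<^sub>C x) = x) \<and> (\<forall>x. X (Y x) - z *\<^sub>C Y x = x))}"

definition op_power :: "('a::real_normed_vector \<Rightarrow>\<^sub>L 'a) \<Rightarrow> nat \<Rightarrow> ('a \<Rightarrow>\<^sub>L 'a)" where
  "op_power X n = ((\<lambda>Y. X o\<^sub>L Y) ^^ n) id_blinfun"

definition poly_op :: "real poly \<Rightarrow> ('a::real_normed_vector \<Rightarrow>\<^sub>L 'a) \<Rightarrow> ('a \<Rightarrow>\<^sub>L 'a)" where
  "poly_op q X = (\<Sum>i\<le>degree q. coeff q i *\<^sub>R op_power X i)"

text \<open>
  Continuous functional calculus of a self-adjoint operator \<open>X\<close> (whose spectrum is real and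
  compact) at a real function \<open>f\<close> that is continuous on the spectrum: the norm limit of \<open>q\<^sub>n(X)\<close>
  for any real polynomials \<open>q\<^sub>n\<close> converging to \<open>f\<close> uniformly on the spectrum.
  The value is unspecified for other arguments.
\<close>

definition cfc :: "(real \<Rightarrow> real) \<Rightarrow> ('a::chilbert_space \<Rightarrow>\<^sub>L 'a) \<Rightarrow> ('a \<Rightarrow>\<^sub>L 'a)" where
  "cfc f X = (THE Y. \<exists>q :: nat \<Rightarrow> real poly.
     uniform_limit {t. complex_of_real t \<in> spectrum X} (\<lambda>n. poly (q n)) f sequentially \<and>
     (\<lambda>n. poly_op (q n) X) \<longlonglongrightarrow> Y)"

definition abs_op :: "('a::chilbert_space \<Rightarrow>\<^sub>L 'a) \<Rightarrow> ('a \<Rightarrow>\<^sub>L 'a)" where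
  "abs_op X = cfc sqrt (adj X o\<^sub>L X)"

text \<open>Real powers, for positive operators and positive exponents.\<close>

definition op_powr :: "('a::chilbert_space \<Rightarrow>\<^sub>L 'a) \<Rightarrow> real \<Rightarrow> ('a \<Rightarrow>\<^sub>L 'a)" where
  "op_powr X r = cfc (\<lambda>t. t powr r) X"

end

theory Submission
  imports Defs "HOL-Computational_Algebra.Fundamental_Theorem_Algebra"
begin

text \<open>
  Suppose that the space is not zero. The refinement terms in the inequality vanish: if \<open>F\<close> is a
  positive operator, then \<open>\<parallel>F\<parallel>\<close> lies in its spectrum, so \<open>F\<^sup>2 - \<parallel>F\<parallel>\<^sup>2\<close> and all positive powers
  of its modulus fail to be bounded below and their \<^const>\<open>ell\<close> is 0. Each bracket, with its exponent, is
  therefore at least \<open>\<parallel>F\<parallel>\<close>, where \<open>F\<close> is \<open>f(|T|)\<close> or \<open>g(|T\<^sup>*|)\<close> (\<open>norm_le_refined_factor\<close>). Moreover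
  \<open>\<parallel>T\<parallel> = \<parallel>T\<^sup>*\<parallel>\<close> is in the spectrum of both \<open>|T|\<close> and \<open>|T\<^sup>*|\<close>, so
  \<open>\<parallel>f(|T|)\<parallel> \<parallel>g(|T\<^sup>*|)\<parallel> \<ge> f(\<parallel>T\<parallel>) g(\<parallel>T\<parallel>) = \<parallel>T\<parallel>\<close>.

  It remains to bound the numerical radius of \<open>T S\<close> by \<open>\<parallel>T\<parallel> sqrt \<parallel>S\<^sup>2\<parallel>\<close>, which is
  enough because the square root is at most \<open>\<parallel>S\<parallel>\<close>. With \<open>A = |T|\<close> one has
  \<open>\<parallel>T S x\<parallel> = \<parallel>A S x\<parallel>\<close>; the hypothesis says that \<open>A S\<close> is self-adjoint, and the Cauchy--Schwarz
  inequality for the form of \<open>A\<close> bounds its norm (\<open>norm_symmetrized_product_le\<close>).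

  The rest constructs the tools. The functional calculus only sees real points of the spectrum,
  and almost all arguments take place in the underlying real Hilbert space. The Lax--Milgram
  theorem yields adjoints and locates the spectrum of a positive operator in \<open>[0, \<parallel>X\<parallel>]\<close>. Factoring real
  polynomials gives \<open>\<parallel>q(X)\<parallel> \<le> sup |q|\<close> over the real spectrum (\<open>norm_poly_op_le\<close>), which
  makes the functional calculus well defined (\<open>cfc_tendsto\<close>). Spectral arguments are
  carried out with approximate eigenvalues, which any continuous function maps to approximate
  eigenvalues (\<open>approx_eigenvalue_cfc\<close>); they replace the full spectral mapping theorem. On the zero
  space there are no unit vectors and the numerical radius is 0.
\<close>

section \<open>Symmetric coercive operators and adjoints\<close>

text \<open>
  The Lax--Milgram theorem for symmetric forms, by minimising
  \<open>\<langle>B x, x\<rangle> - 2 \<phi>(x)\<close>. For \<open>B = 1\<close> it is the Riesz representation theorem.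
\<close>

lemma coercive_representation:
  fixes B :: "'a::{real_inner,complete_space} \<Rightarrow>\<^sub>L 'a" and \<phi> :: "'a \<Rightarrow> real"
  assumes sym: "\<And>x y. inner (B x) y = inner x (B y)"
    and m: "m > 0" and coer: "\<And>x. m * (norm x)\<^sup>2 \<le> inner (B x) x"
    and \<phi>: "bounded_linear \<phi>"
  obtains y where "\<And>x. inner (B y) x = \<phi> x"
proof -
  interpret \<phi>: bounded_linear \<phi> by fact
  define J where "J x = inner (B x) x - 2 * \<phi> x" for x
  obtain K where K: "\<And>x. \<bar>\<phi> x\<bar> \<le> norm x * K"
    using \<phi>.bounded by auto
  have lower: "- (K\<^sup>2 / m) \<le> J x" for x
  proof -
    have "0 \<le> (m * norm x - K)\<^sup>2" by simp
    then have "2 * (norm x * K) * m \<le> m * (norm x)\<^sup>2 * m + K\<^sup>2"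
      by (simp add: power2_eq_square algebra_simps)
    then have "2 * (norm x * K) \<le> m * (norm x)\<^sup>2 + K\<^sup>2 / m"
      using m by (simp add: field_simps)
    then show ?thesis using coer[of x] K[of x] unfolding J_def by linarith
  qed
  define I where "I = Inf (range J)"
  have bdd: "bdd_below (range J)" by (rule bdd_belowI2[OF lower])
  have I_le: "I \<le> J x" for x unfolding I_def using bdd by (simp add: cInf_lower)
  have "\<exists>x. J x < I + 1 / real (Suc n)" for n
  proof -
    have "Inf (range J) < I + 1 / real (Suc n)" unfolding I_def by simp
    then show ?thesis using cInf_lessD[of "range J"] by fastforce
  qed
  then obtain u where u: "\<And>n. J (u n) < I + 1 / real (Suc n)" by metis
  \<comment> \<open>The parallelogram identity for \<open>J\<close> makes every minimising sequence a Cauchy sequence.\<close>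
  have par: "m * (norm (x - y))\<^sup>2 \<le> 2 * J x + 2 * J y - 4 * I" for x y
  proof -
    have "J ((1/2) *\<^sub>R (x + y)) = inner (B (x + y)) (x + y) / 4 - \<phi> (x + y)"
      unfolding J_def by (simp add: blinfun.scaleR_right \<phi>.scaleR)
    then have "2 * J x + 2 * J y - 4 * J ((1/2) *\<^sub>R (x + y)) = inner (B (x - y)) (x - y)"
      unfolding J_def
      by (simp add: blinfun.add_right blinfun.diff_right \<phi>.add inner_add inner_diff algebra_simps)
    then show ?thesis using coer[of "x - y"] I_le[of "(1/2) *\<^sub>R (x + y)"] by linarith
  qed
  have "Cauchy u"
  proof (rule metric_CauchyI)
    fix e :: real assume e: "e > 0"
    obtain N where N: "4 / (m * e\<^sup>2) < real N" using reals_Archimedean2 by blast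
    have N0: "4 / real (Suc N) < m * e\<^sup>2"
    proof -
      have "4 / (m * e\<^sup>2) < real (Suc N)" using N by simp
      then show ?thesis using m e by (simp add: field_simps)
    qed
    have "dist (u k) (u l) < e" if "k \<ge> N" "l \<ge> N" for k l
    proof -
      have *: "1 / real (Suc i) \<le> 1 / real (Suc N)" if "i \<ge> N" for i
        using that by (simp add: frac_le)
      have "m * (norm (u k - u l))\<^sup>2 \<le> 2 * J (u k) + 2 * J (u l) - 4 * I" by (rule par)
      also have "\<dots> \<le> 4 * (1 / real (Suc N))"
        using u[of k] u[of l] *[OF that(1)] *[OF that(2)] by linarith
      also have "\<dots> < m * e\<^sup>2" using N0 by simp
      finally have "(norm (u k - u l))\<^sup>2 < e\<^sup>2" using m by simp
      then show ?thesis using e by (simp add: dist_norm power_less_imp_less_base)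
    qed
    then show "\<exists>M. \<forall>k\<ge>M. \<forall>l\<ge>M. dist (u k) (u l) < e" by blast
  qed
  then obtain y where y: "u \<longlonglongrightarrow> y" using Cauchy_convergent convergent_def by blast
  have "(\<lambda>n. J (u n)) \<longlonglongrightarrow> J y"
    unfolding J_def by (intro tendsto_intros y blinfun.tendsto \<phi>.tendsto)
  moreover have "(\<lambda>n. I + 1 / real (Suc n)) \<longlonglongrightarrow> I + 0"
    by (intro tendsto_intros LIMSEQ_Suc[OF lim_1_over_n])
  ultimately have Jy: "J y \<le> I"
    using LIMSEQ_le[of "\<lambda>n. J (u n)" "J y" "\<lambda>n. I + 1 / real (Suc n)" I] u
    by (auto intro: less_imp_le)
  have "inner (B y) x = \<phi> x" for x
  proof (rule ccontr)
    define a where "a = inner (B y) x - \<phi> x"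
    define b where "b = inner (B x) x + 1"
    assume "inner (B y) x \<noteq> \<phi> x"
    then have a: "a \<noteq> 0" by (simp add: a_def)
    have b: "b > 0" using coer[of x] m unfolding b_def
      by (smt (verit, best) mult_nonneg_nonneg zero_le_power2)
    \<comment> \<open>The form at \<open>x\<close> is \<open>b - 1\<close>; the summand 1 keeps the denominator positive even for \<open>x = 0\<close>.\<close>
    define t where "t = - a / b"
    have exp: "J (y + t *\<^sub>R x) = J y + 2 * t * a + t\<^sup>2 * (b - 1)"
      unfolding J_def a_def b_def
      by (simp add: blinfun.add_right blinfun.scaleR_right \<phi>.add \<phi>.scaleR inner_add
          sym[of x y] inner_commute[of x "B y"] power2_eq_square algebra_simps)
    have "2 * t * a + t\<^sup>2 * b < 0"
    proof -
      have "t * b = - a" using b by (simp add: t_def)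
      then have "2 * t * a + t\<^sup>2 * b = t * a" by (simp add: power2_eq_square mult.assoc)
      moreover have "t * a = - (a\<^sup>2 / b)" by (simp add: t_def power2_eq_square)
      moreover have "a\<^sup>2 / b > 0" using a b by simp
      ultimately show ?thesis by linarith
    qed
    moreover have "t\<^sup>2 \<ge> 0" by simp
    moreover have "t\<^sup>2 * (b - 1) = t\<^sup>2 * b - t\<^sup>2" by (simp add: right_diff_distrib)
    ultimately have "2 * t * a + t\<^sup>2 * (b - 1) < 0" by linarith
    then show False using exp I_le[of "y + t *\<^sub>R x"] Jy by linarith
  qed
  then show ?thesis using that by blast
qed

text \<open>
  The complex inner product is recovered from its real part, so that adjoints, symmetry and
  positivity can be treated in the underlying real Hilbert space; complex linearity of an
  operator is only commutation with multiplication by \<open>\<i>\<close>.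
\<close>

lemma cinner_unfold:
  "cinner x y = Complex (inner x y) (- inner (\<i> *\<^sub>C x) y)"
  by (simp add: complex_eq_iff inner_eq_Re_cinner cinner_scaleC_left)

lemma inner_ii: "inner (\<i> *\<^sub>C x) y = - inner x (\<i> *\<^sub>C y)"
  for x y :: "'a::complex_inner"
  by (metis cinner_commute cinner_scaleC_left inner_commute inner_eq_Re_cinner
      complex_cnj_i complex_cnj_mult mult_minus_left uminus_complex.simps(1) complex_cnj_cnj cnj.simps(1))

lemma scaleC_decompose: "c *\<^sub>C x = Re c *\<^sub>R x + Im c *\<^sub>R (\<i> *\<^sub>C x)"
  for x :: "'a::complex_inner"
  by (metis complex_eq mult.commute scaleC_add_left scaleC_scaleC scaleR_scaleC)

lemma clinear_op_iff_ii:
  "clinear_op X \<longleftrightarrow> (\<forall>x. X (\<i> *\<^sub>C x) = \<i> *\<^sub>C X x)"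
proof
  assume *: "\<forall>x. X (\<i> *\<^sub>C x) = \<i> *\<^sub>C X x"
  show "clinear_op X"
    unfolding clinear_op_def
    by (subst (1 2) scaleC_decompose) (auto simp: blinfun.add_right blinfun.scaleR_right *)
qed (auto simp: clinear_op_def)

lemma norm_cinner_le: "cmod (cinner x y) \<le> norm x * norm y"
  for x y :: "'a::complex_inner"
proof (cases "cinner x y = 0")
  case False
  define c where "c = cinner x y"
  \<comment> \<open>A phase that makes \<open>v * c\<close> real and nonnegative, so that the real inequality applies.\<close>
  define v where "v = cnj c / cmod c"
  have c: "c \<noteq> 0" using False by (simp add: c_def)
  have cc: "cnj c * c = complex_of_real (cmod c) * complex_of_real (cmod c)"
    using complex_norm_square[of c] by (simp add: power2_eq_square mult.commute)
  have v: "v * cnj v = 1" "v * c = cmod c"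
    using c cc by (simp_all add: v_def)
  have "cinner x (v *\<^sub>C x) = cnj v * cinner x x"
    by (subst (1 2) cinner_commute) (simp add: cinner_scaleC_left)
  then have "(norm (v *\<^sub>C x))\<^sup>2 = Re (v * cnj v * cinner x x)"
    by (simp add: inner_eq_Re_cinner cinner_scaleC_left mult.assoc
        del: times_complex.sel flip: dot_square_norm)
  then have "(norm (v *\<^sub>C x))\<^sup>2 = (norm x)\<^sup>2"
    by (simp add: v(1) flip: inner_eq_Re_cinner dot_square_norm)
  then have n: "norm (v *\<^sub>C x) = norm x" by simp
  have "cmod c = Re (v * c)" by (simp add: v(2))
  also have "\<dots> = inner (v *\<^sub>C x) y"
    by (simp add: inner_eq_Re_cinner cinner_scaleC_left c_def)
  also have "\<dots> \<le> norm x * norm y" using norm_cauchy_schwarz[of "v *\<^sub>C x" y] n by simp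
  finally show ?thesis by (simp add: c_def)
qed auto

lemma real_adjoint_exists:
  fixes X :: "'a::{real_inner,complete_space} \<Rightarrow>\<^sub>L 'a"
  obtains Y :: "'a \<Rightarrow>\<^sub>L 'a" where "\<And>x y. inner (X x) y = inner x (Y y)"
proof -
  have "\<exists>z. \<forall>x. inner z x = inner (X x) y" for y
  proof -
    have "bounded_linear (\<lambda>x. inner (X x) y)"
      by (intro bounded_linear_inner_left_comp blinfun.bounded_linear_right)
    then obtain z where "\<And>x. inner (id_blinfun z) x = inner (X x) y"
      using coercive_representation[of id_blinfun 1 "\<lambda>x. inner (X x) y"]
      by (auto simp: dot_square_norm)
    then show ?thesis by auto
  qed
  then obtain F where F: "\<And>x y. inner (F y) x = inner (X x) y" by metis
  have add: "F (a + b) = F a + F b" and sc: "F (r *\<^sub>R a) = r *\<^sub>R F a" for a b r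
    by (rule vector_eq_ldot[THEN iffD1]; simp add: inner_commute[of _ "F _"] F inner_add)+
  have nF: "norm (F y) \<le> norm y * norm X" for y
  proof -
    have "norm (F y) * norm (F y) = inner (X (F y)) y"
      using F[of y "F y"] by (simp add: dot_square_norm power2_eq_square)
    also have "\<dots> \<le> norm (X (F y)) * norm y" by (rule norm_cauchy_schwarz)
    also have "\<dots> \<le> norm X * norm (F y) * norm y"
      by (intro mult_right_mono norm_blinfun) auto
    finally have "norm (F y) * norm (F y) \<le> norm (F y) * (norm y * norm X)" by (simp add: ac_simps)
    then show ?thesis
      by (metis mult_left_le_imp_le mult_nonneg_nonneg norm_ge_zero order_le_less)
  qed
  have "bounded_linear F" by (rule bounded_linear_intro[OF add sc nF])
  then have "inner (X x) y = inner x (Blinfun F y)" for x y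
    by (simp add: bounded_linear_Blinfun_apply F inner_commute[of x])
  then show ?thesis using that by blast
qed

lemma
  assumes X: "clinear_op X"
  shows inner_adj: "inner (X x) y = inner x (adj X y)"
    and clinear_adj: "clinear_op (adj X)"
proof -
  obtain Y :: "'a \<Rightarrow>\<^sub>L 'a" where Y: "\<And>x y. inner (X x) y = inner x (Y y)"
    using real_adjoint_exists[of X] by blast
  have c: "cinner (X x) y = cinner x (Y y)" for x y
    using X by (simp add: cinner_unfold[of "X x"] cinner_unfold[of x] Y[symmetric] clinear_op_def)
  have un: "Z = Y" if Z: "\<forall>x y. cinner (X x) y = cinner x (Z y)" for Z :: "'a \<Rightarrow>\<^sub>L 'a"
  proof (rule blinfun_eqI, rule vector_eq_ldot[THEN iffD1], rule allI)
    show "inner x (Z y) = inner x (Y y)" for x y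
      by (simp add: inner_eq_Re_cinner c[symmetric] Z)
  qed
  have adj: "adj X = Y"
    unfolding adj_def by (rule the_equality) (use c un in auto)
  show "inner (X x) y = inner x (adj X y)" by (simp add: adj Y)
  have "Y (\<i> *\<^sub>C y) = \<i> *\<^sub>C Y y" for y
  proof (rule vector_eq_ldot[THEN iffD1], rule allI)
    fix x
    have "inner x (Y (\<i> *\<^sub>C y)) = - inner (\<i> *\<^sub>C X x) y" by (simp add: inner_ii flip: Y)
    also have "\<dots> = - inner (\<i> *\<^sub>C x) (Y y)"
      using X by (simp add: clinear_op_def flip: Y)
    finally show "inner x (Y (\<i> *\<^sub>C y)) = inner x (\<i> *\<^sub>C Y y)" by (simp add: inner_ii)
  qed
  then show "clinear_op (adj X)" by (simp add: adj clinear_op_iff_ii)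
qed

lemma inner_adj_right:
  "clinear_op X \<Longrightarrow> inner (adj X x) y = inner x (X y)"
  by (metis inner_adj inner_commute)

lemma adj_unique:
  fixes X Y :: "'a::chilbert_space \<Rightarrow>\<^sub>L 'a"
  assumes "clinear_op X" and "\<And>x y. inner (X x) y = inner x (Y y)"
  shows "adj X = Y"
  by (rule blinfun_eqI, rule vector_eq_ldot[THEN iffD1]) (simp flip: assms(2) inner_adj[OF assms(1)])

lemma adj_adj: "clinear_op X \<Longrightarrow> adj (adj X) = X"
  by (rule adj_unique) (auto simp: clinear_adj inner_adj_right)

lemma norm_adj_le: "clinear_op X \<Longrightarrow> norm (adj X) \<le> norm X"
proof (rule norm_blinfun_bound)
  fix y assume X: "clinear_op X"
  have "norm (adj X y) * norm (adj X y) = inner (X (adj X y)) y"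
    by (simp add: inner_adj[OF X] dot_square_norm power2_eq_square)
  also have "\<dots> \<le> norm (X (adj X y)) * norm y" by (rule norm_cauchy_schwarz)
  also have "\<dots> \<le> norm X * norm (adj X y) * norm y"
    by (intro mult_right_mono norm_blinfun) auto
  finally have "norm (adj X y) * norm (adj X y) \<le> norm (adj X y) * (norm X * norm y)"
    by (simp add: ac_simps)
  then show "norm (adj X y) \<le> norm X * norm y"
    by (metis mult_left_le_imp_le mult_nonneg_nonneg norm_ge_zero order_le_less)
qed auto

lemma norm_adj: "clinear_op X \<Longrightarrow> norm (adj X) = norm X"
  by (metis adj_adj clinear_adj norm_adj_le order_antisym)

text \<open>
  Consequently the bounded operators on a Hilbert space form a Banach space.
\<close>

instance chilbert_space \<subseteq> banach ..

section \<open>Approximate eigenvalues and the real spectrum\<close>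

text \<open>
  Operators for which \<open>\<parallel>A x\<parallel>\<close> dominates a fixed positive multiple of \<open>\<parallel>x\<parallel>\<close>.
\<close>

definition bounded_below_op :: "('a::real_normed_vector \<Rightarrow>\<^sub>L 'a) \<Rightarrow> bool" where
  "bounded_below_op A \<longleftrightarrow> (\<exists>c>0. \<forall>x. c * norm x \<le> norm (A x))"

text \<open>
  Real approximate eigenvalues: some unit vectors \<open>x\<^sub>n\<close> satisfy \<open>A x\<^sub>n - t x\<^sub>n \<rightarrow> 0\<close>.
\<close>

definition approx_eigenvalue :: "('a::real_normed_vector \<Rightarrow>\<^sub>L 'a) \<Rightarrow> real \<Rightarrow> bool" where
  "approx_eigenvalue A t \<longleftrightarrow> (\<forall>e>0. \<exists>x. norm x = 1 \<and> norm (A x - t *\<^sub>R x) < e)"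

text \<open>
  Symmetry for the real inner product. For a complex-linear operator this is the same as
  self-adjointness, because the imaginary part of \<^const>\<open>cinner\<close> is determined by the real part.
\<close>

definition symmetric_op :: "('a::real_inner \<Rightarrow>\<^sub>L 'a) \<Rightarrow> bool" where
  "symmetric_op A \<longleftrightarrow> (\<forall>x y. inner (A x) y = inner x (A y))"

text \<open>
  Positive operators. Symmetry is required explicitly, since it does not follow from
  nonnegativity of the quadratic form over the reals.
\<close>

definition positive_op :: "('a::real_inner \<Rightarrow>\<^sub>L 'a) \<Rightarrow> bool" where
  "positive_op A \<longleftrightarrow> symmetric_op A \<and> (\<forall>x. 0 \<le> inner (A x) x)"

lemma approx_eigenvalue_iff:
  "approx_eigenvalue A t \<longleftrightarrow> \<not> bounded_below_op (A - t *\<^sub>R id_blinfun)"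
proof
  assume a: "approx_eigenvalue A t"
  show "\<not> bounded_below_op (A - t *\<^sub>R id_blinfun)"
  proof
    assume "bounded_below_op (A - t *\<^sub>R id_blinfun)"
    then obtain c where c: "c > 0" "\<And>x. c * norm x \<le> norm (A x - t *\<^sub>R x)"
      by (auto simp: bounded_below_op_def blinfun.diff_left blinfun.scaleR_left)
    from a c(1) obtain x where "norm x = 1" "norm (A x - t *\<^sub>R x) < c"
      unfolding approx_eigenvalue_def by blast
    with c(2)[of x] show False by simp
  qed
next
  assume n: "\<not> bounded_below_op (A - t *\<^sub>R id_blinfun)"
  show "approx_eigenvalue A t"
    unfolding approx_eigenvalue_def
  proof (intro allI impI)
    fix e :: real assume "e > 0"
    with n obtain x where x: "norm (A x - t *\<^sub>R x) < e * norm x"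
      unfolding bounded_below_op_def
      by (auto simp: blinfun.diff_left blinfun.scaleR_left not_le)
    then have "x \<noteq> 0" by auto
    define u where "u = (1 / norm x) *\<^sub>R x"
    have "A u - t *\<^sub>R u = (1 / norm x) *\<^sub>R (A x - t *\<^sub>R x)"
      by (simp add: u_def blinfun.scaleR_right scaleR_diff_right)
    then have "norm (A u - t *\<^sub>R u) = norm (A x - t *\<^sub>R x) / norm x" by simp
    also have "\<dots> < e" using x \<open>x \<noteq> 0\<close> by (simp add: divide_less_eq)
    finally have "norm (A u - t *\<^sub>R u) < e" .
    moreover have "norm u = 1" using \<open>x \<noteq> 0\<close> by (simp add: u_def)
    ultimately show "\<exists>x. norm x = 1 \<and> norm (A x - t *\<^sub>R x) < e" by blast
  qed
qed

lemma bounded_below_op_compose: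
  assumes "bounded_below_op A" "bounded_below_op B"
  shows "bounded_below_op (A o\<^sub>L B)"
proof -
  obtain a b where a: "a > 0" "\<And>x. a * norm x \<le> norm (A x)"
    and b: "b > 0" "\<And>x. b * norm x \<le> norm (B x)"
    using assms unfolding bounded_below_op_def by blast
  have "(a * b) * norm x \<le> norm (A (B x))" for x
    using order_trans[OF mult_left_mono[OF b(2)[of x], of a] a(2)[of "B x"]] a(1)
    by (simp add: mult.assoc)
  then show ?thesis
    unfolding bounded_below_op_def using a(1) b(1) by (metis blinfun_apply_blinfun_compose mult_pos_pos)
qed

lemma norm_ge_approx_eigenvalue:
  assumes "approx_eigenvalue A t"
  shows "\<bar>t\<bar> \<le> norm A"
proof (rule field_le_epsilon)
  fix e :: real assume "e > 0"
  then obtain x where x: "norm x = 1" "norm (A x - t *\<^sub>R x) < e"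
    using assms unfolding approx_eigenvalue_def by blast
  have "\<bar>t\<bar> = norm (t *\<^sub>R x)" using x by simp
  also have "\<dots> \<le> norm (A x) + norm (A x - t *\<^sub>R x)"
    by (metis norm_triangle_sub add.commute norm_minus_commute)
  also have "\<dots> \<le> norm A + e" using norm_blinfun[of A x] x by simp
  finally show "\<bar>t\<bar> \<le> norm A + e" .
qed

lemma approx_eigenvalue_square:
  assumes "approx_eigenvalue A s"
  shows "approx_eigenvalue (A o\<^sub>L A) (s\<^sup>2)"
proof -
  have "(A + s *\<^sub>R id_blinfun) (A x - s *\<^sub>R x) = A (A x) - s\<^sup>2 *\<^sub>R x" for x
    by (simp add: blinfun.add_left blinfun.scaleR_left blinfun.diff_right blinfun.scaleR_right
        scaleR_add_right scaleR_diff_right power2_eq_square algebra_simps)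
  show ?thesis
    unfolding approx_eigenvalue_def
  proof (intro allI impI)
    fix e :: real assume e: "e > 0"
    define K where "K = norm (A + s *\<^sub>R id_blinfun) + 1"
    have K: "K > 0" unfolding K_def by (smt (verit) norm_ge_zero)
    from e K obtain x where x: "norm x = 1" "norm (A x - s *\<^sub>R x) < e / K"
      using assms unfolding approx_eigenvalue_def by (meson divide_pos_pos)
    have "norm ((A + s *\<^sub>R id_blinfun) (A x - s *\<^sub>R x)) \<le> K * norm (A x - s *\<^sub>R x)"
      using norm_blinfun[of "A + s *\<^sub>R id_blinfun" "A x - s *\<^sub>R x"]
      by (smt (verit) K_def mult_right_mono norm_ge_zero)
    also have "\<dots> < e" using x(2) K by (simp add: field_simps)
    finally show "\<exists>x. norm x = 1 \<and> norm ((A o\<^sub>L A) x - s\<^sup>2 *\<^sub>R x) < e"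
      using x(1) \<open>\<And>x. (A + s *\<^sub>R id_blinfun) (A x - s *\<^sub>R x) = A (A x) - s\<^sup>2 *\<^sub>R x\<close>
      by auto
  qed
qed

lemma in_spectrum_of_real:
  "complex_of_real t \<in> spectrum X \<longleftrightarrow>
    \<not> (\<exists>Y :: 'a::complex_inner \<Rightarrow>\<^sub>L 'a. (\<forall>x. Y (X x - t *\<^sub>R x) = x) \<and> (\<forall>x. X (Y x) - t *\<^sub>R Y x = x))"
  by (simp add: spectrum_def scaleR_scaleC)

lemma approx_eigenvalue_in_spectrum:
  fixes X :: "'a::complex_inner \<Rightarrow>\<^sub>L 'a"
  assumes "approx_eigenvalue X t"
  shows "complex_of_real t \<in> spectrum X"
proof (rule ccontr)
  assume "complex_of_real t \<notin> spectrum X"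
  then obtain Y :: "'a \<Rightarrow>\<^sub>L 'a" where Y: "\<And>x. Y (X x - t *\<^sub>R x) = x"
    by (auto simp: in_spectrum_of_real)
  have K: "norm Y + 1 > 0" by (smt (verit) norm_ge_zero)
  have "norm x \<le> (norm Y + 1) * norm (X x - t *\<^sub>R x)" for x
  proof -
    have "norm x \<le> norm Y * norm (X x - t *\<^sub>R x)"
      using norm_blinfun[of Y "X x - t *\<^sub>R x"] by (simp add: Y)
    also have "\<dots> \<le> (norm Y + 1) * norm (X x - t *\<^sub>R x)" by (intro mult_right_mono) auto
    finally show ?thesis .
  qed
  then have "bounded_below_op (X - t *\<^sub>R id_blinfun)"
    unfolding bounded_below_op_def using K
    by (intro exI[of _ "1 / (norm Y + 1)"])
       (auto simp: blinfun.diff_left blinfun.scaleR_left field_simps)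
  then show False using assms approx_eigenvalue_iff by blast
qed

lemma coercive_invertible:
  fixes B :: "'a::{real_inner,complete_space} \<Rightarrow>\<^sub>L 'a"
  assumes sym: "symmetric_op B" and m: "m > 0"
    and coer: "\<And>x. m * (norm x)\<^sup>2 \<le> inner (B x) x"
  obtains Y :: "'a \<Rightarrow>\<^sub>L 'a" where "\<And>x. Y (B x) = x" "\<And>x. B (Y x) = x"
proof -
  have below: "m * norm x \<le> norm (B x)" for x
  proof (cases "x = 0")
    case False
    have "m * norm x * norm x \<le> norm (B x) * norm x"
      using coer[of x] norm_cauchy_schwarz[of "B x" x] by (simp add: power2_eq_square mult.assoc)
    then show ?thesis using False by simp
  qed auto
  have "\<exists>y. B y = z" for z
  proof -
    obtain y where "\<And>x. inner (B y) x = inner z x"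
      using coercive_representation[OF _ m coer bounded_linear_inner_right, of z] sym
      unfolding symmetric_op_def by blast
    then show ?thesis using vector_eq_rdot by blast
  qed
  then obtain F where F: "\<And>z. B (F z) = z" by metis
  have inj: "x = y" if "B x = B y" for x y
    using below[of "x - y"] that m by (simp add: blinfun.diff_right mult_le_0_iff)
  have "bounded_linear F"
  proof (rule bounded_linear_intro[where K = "1 / m"])
    show "F (x + y) = F x + F y" for x y by (rule inj) (simp add: F blinfun.add_right)
    show "F (r *\<^sub>R x) = r *\<^sub>R F x" for r x by (rule inj) (simp add: F blinfun.scaleR_right)
    show "norm (F x) \<le> norm x * (1 / m)" for x using below[of "F x"] m by (simp add: F field_simps)
  qed
  then have "Blinfun F (B x) = x" "B (Blinfun F x) = x" for x
    by (auto simp: bounded_linear_Blinfun_apply F intro: inj)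
  then show ?thesis using that by blast
qed

lemma spectrum_ge:
  fixes X :: "'a::chilbert_space \<Rightarrow>\<^sub>L 'a"
  assumes sym: "symmetric_op X" and lb: "\<And>x. a * (norm x)\<^sup>2 \<le> inner (X x) x"
    and t: "complex_of_real t \<in> spectrum X"
  shows "a \<le> t"
proof (rule ccontr)
  assume "\<not> a \<le> t"
  then have m: "a - t > 0" by simp
  have s: "symmetric_op (X - t *\<^sub>R id_blinfun)"
    using sym by (simp add: symmetric_op_def blinfun.diff_left blinfun.scaleR_left inner_diff)
  have c: "(a - t) * (norm x)\<^sup>2 \<le> inner ((X - t *\<^sub>R id_blinfun) x) x" for x
    using lb[of x]
    by (simp add: blinfun.diff_left blinfun.scaleR_left inner_diff dot_square_norm algebra_simps)
  obtain Y :: "'a \<Rightarrow>\<^sub>L 'a" where "\<And>x. Y ((X - t *\<^sub>R id_blinfun) x) = x"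
    "\<And>x. (X - t *\<^sub>R id_blinfun) (Y x) = x"
    using coercive_invertible[OF s m c] by metis
  then have "(\<forall>x. Y (X x - t *\<^sub>R x) = x) \<and> (\<forall>x. X (Y x) - t *\<^sub>R Y x = x)"
    by (simp add: blinfun.diff_left blinfun.scaleR_left)
  then show False using t unfolding in_spectrum_of_real by blast
qed

lemma spectrum_le:
  fixes X :: "'a::chilbert_space \<Rightarrow>\<^sub>L 'a"
  assumes sym: "symmetric_op X" and t: "complex_of_real t \<in> spectrum X"
  shows "t \<le> norm X"
proof (rule ccontr)
  assume "\<not> t \<le> norm X"
  then have m: "t - norm X > 0" by simp
  have s: "symmetric_op (t *\<^sub>R id_blinfun - X)"
    using sym by (simp add: symmetric_op_def blinfun.diff_left blinfun.scaleR_left inner_diff)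
  have c: "(t - norm X) * (norm x)\<^sup>2 \<le> inner ((t *\<^sub>R id_blinfun - X) x) x" for x
  proof -
    have "inner (X x) x \<le> norm X * norm x * norm x"
      by (meson norm_blinfun norm_cauchy_schwarz mult_right_mono norm_ge_zero order_trans)
    then show ?thesis
      by (simp add: blinfun.diff_left blinfun.scaleR_left inner_diff dot_square_norm
          power2_eq_square algebra_simps)
  qed
  obtain Y :: "'a \<Rightarrow>\<^sub>L 'a" where Y: "\<And>x. Y ((t *\<^sub>R id_blinfun - X) x) = x"
    "\<And>x. (t *\<^sub>R id_blinfun - X) (Y x) = x"
    using coercive_invertible[OF s m c] by metis
  have "(- Y) (X x - t *\<^sub>R x) = x" "X ((- Y) x) - t *\<^sub>R (- Y) x = x" for x
    using Y(1)[of x] Y(2)[of x]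
    by (simp_all add: blinfun.diff_left blinfun.scaleR_left blinfun.minus_left blinfun.minus_right
        blinfun.diff_right)
  then have "(\<forall>x. (- Y) (X x - t *\<^sub>R x) = x) \<and> (\<forall>x. X ((- Y) x) - t *\<^sub>R (- Y) x = x)"
    by blast
  then show False using t unfolding in_spectrum_of_real by blast
qed

lemma spectrum_positive_op:
  fixes X :: "'a::chilbert_space \<Rightarrow>\<^sub>L 'a"
  assumes "positive_op X"
  shows "{t. complex_of_real t \<in> spectrum X} \<subseteq> {0..norm X}"
  using assms spectrum_ge[of X 0] spectrum_le[of X] by (auto simp: positive_op_def)

text \<open>
  If \<open>B\<close> is the adjoint of \<open>A\<close> then \<open>\<parallel>A\<parallel>\<^sup>2\<close> is an approximate eigenvalue of \<open>B A\<close>, because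
  \<open>\<parallel>B A x - \<parallel>A\<parallel>\<^sup>2 x\<parallel>\<^sup>2 \<le> \<parallel>A\<parallel>\<^sup>2 (\<parallel>A\<parallel>\<^sup>2 \<parallel>x\<parallel>\<^sup>2 - \<parallel>A x\<parallel>\<^sup>2)\<close>. The unit vector \<open>e\<close>
  only rules out the zero space, which has no approximate eigenvalues.
\<close>

lemma approx_eigenvalue_adjoint_square:
  fixes A B :: "'a::real_inner \<Rightarrow>\<^sub>L 'a"
  assumes adj: "\<And>x y. inner (A x) y = inner x (B y)" and nB: "norm B \<le> norm A"
    and e: "norm (e::'a) = 1"
  shows "approx_eigenvalue (B o\<^sub>L A) ((norm A)\<^sup>2)"
  unfolding approx_eigenvalue_iff
proof
  define M where "M = norm A"
  have M0: "M \<ge> 0" by (simp add: M_def)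
  assume "bounded_below_op ((B o\<^sub>L A) - (norm A)\<^sup>2 *\<^sub>R id_blinfun)"
  then obtain c where c: "c > 0" "\<And>x. c * norm x \<le> norm (B (A x) - M\<^sup>2 *\<^sub>R x)"
    by (auto simp: bounded_below_op_def blinfun.diff_left blinfun.scaleR_left M_def)
  have main: "c\<^sup>2 * (norm x)\<^sup>2 \<le> M\<^sup>2 * (M\<^sup>2 * (norm x)\<^sup>2 - (norm (A x))\<^sup>2)" for x
  proof -
    have "norm (B (A x)) \<le> M * norm (A x)"
      using norm_blinfun[of B "A x"] nB
      by (smt (verit) M_def mult_right_mono norm_ge_zero)
    then have BA: "(norm (B (A x)))\<^sup>2 \<le> M\<^sup>2 * (norm (A x))\<^sup>2"
      by (metis norm_ge_zero power_mono power_mult_distrib)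
    have "(c * norm x)\<^sup>2 \<le> (norm (B (A x) - M\<^sup>2 *\<^sub>R x))\<^sup>2"
      using c by (intro power_mono) auto
    also have "\<dots> = (norm (B (A x)))\<^sup>2 - 2 * M\<^sup>2 * inner (B (A x)) x + M\<^sup>2 * M\<^sup>2 * (norm x)\<^sup>2"
      by (simp add: inner_diff inner_commute algebra_simps flip: dot_square_norm)
    also have "inner (B (A x)) x = (norm (A x))\<^sup>2"
      using adj[of x "A x"] by (simp add: dot_square_norm inner_commute)
    finally show ?thesis using BA by (simp add: power_mult_distrib algebra_simps)
  qed
  show False
  proof (cases "M = 0")
    case True
    then show False using main[of e] e c(1) by simp
  next
    case False
    then have M: "M > 0" using M0 by simp
    define b where "b = M\<^sup>2 - c\<^sup>2 / M\<^sup>2"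
    have bx: "(norm (A x))\<^sup>2 \<le> b * (norm x)\<^sup>2" for x
    proof -
      have "c\<^sup>2 / M\<^sup>2 * (norm x)\<^sup>2 \<le> M\<^sup>2 * (norm x)\<^sup>2 - (norm (A x))\<^sup>2"
        using main[of x] M by (simp add: field_simps)
      then show ?thesis by (simp add: b_def algebra_simps)
    qed
    have b0: "b \<ge> 0" using bx[of e] e by (smt (verit) mult_cancel_left2 one_power2 zero_le_power2)
    have "norm (A x) \<le> sqrt b * norm x" for x
      using real_sqrt_le_mono[OF bx[of x]] by (simp add: real_sqrt_mult)
    then have "M \<le> sqrt b" unfolding M_def using b0 by (intro norm_blinfun_bound) auto
    then have "M\<^sup>2 \<le> b" using M0 b0 by (metis power_mono real_sqrt_pow2)
    moreover have "c\<^sup>2 / M\<^sup>2 > 0" using c(1) M by simp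
    ultimately show False by (simp add: b_def)
  qed
qed

lemma symmetric_op_norm_approx_eigenvalue:
  fixes B :: "'a::real_inner \<Rightarrow>\<^sub>L 'a"
  assumes sym: "symmetric_op B" and e: "norm (e::'a) = 1"
  shows "approx_eigenvalue B (norm B) \<or> approx_eigenvalue B (- norm B)"
proof (rule ccontr)
  let ?M = "norm B"
  assume "\<not> ?thesis"
  then have "bounded_below_op ((B - ?M *\<^sub>R id_blinfun) o\<^sub>L (B - (- ?M) *\<^sub>R id_blinfun))"
    by (intro bounded_below_op_compose) (auto simp: approx_eigenvalue_iff)
  also have "((B - ?M *\<^sub>R id_blinfun) o\<^sub>L (B - (- ?M) *\<^sub>R id_blinfun))
      = (B o\<^sub>L B) - ?M\<^sup>2 *\<^sub>R id_blinfun"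
    by (rule blinfun_eqI)
       (simp add: blinfun.diff_left blinfun.add_left blinfun.add_right blinfun.scaleR_left
        blinfun.scaleR_right power2_eq_square algebra_simps)
  finally have "\<not> approx_eigenvalue (B o\<^sub>L B) (?M\<^sup>2)" by (simp add: approx_eigenvalue_iff)
  moreover have "approx_eigenvalue (B o\<^sub>L B) (?M\<^sup>2)"
    by (rule approx_eigenvalue_adjoint_square[OF _ _ e]) (use sym in \<open>auto simp: symmetric_op_def\<close>)
  ultimately show False by blast
qed

lemma positive_op_norm_approx_eigenvalue:
  fixes B :: "'a::real_inner \<Rightarrow>\<^sub>L 'a"
  assumes pos: "positive_op B" and e: "norm (e::'a) = 1"
  shows "approx_eigenvalue B (norm B)"
proof (rule ccontr)
  assume n: "\<not> ?thesis"
  then have neg: "approx_eigenvalue B (- norm B)"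
    using symmetric_op_norm_approx_eigenvalue[OF _ e] pos unfolding positive_op_def by blast
  then have "norm B \<noteq> 0" using n by force
  then obtain x where x: "norm x = 1" "norm (B x - (- norm B) *\<^sub>R x) < norm B"
    using neg unfolding approx_eigenvalue_def by (metis norm_ge_zero order_le_less)
  have "inner (B x) x + norm B = inner (B x - (- norm B) *\<^sub>R x) x"
    using x(1) by (simp add: inner_add dot_square_norm)
  also have "\<dots> \<le> norm (B x - (- norm B) *\<^sub>R x)"
    using norm_cauchy_schwarz[of "B x - (- norm B) *\<^sub>R x" x] x(1) by simp
  finally show False using x(2) pos unfolding positive_op_def by (smt (verit))
qed

section \<open>Polynomials in an operator\<close>

lemma poly_op_cover:
  "degree q \<le> n \<Longrightarrow> poly_op q X = (\<Sum>i\<le>n. coeff q i *\<^sub>R op_power X i)"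
  unfolding poly_op_def
  by (rule sum.mono_neutral_left) (auto simp: coeff_eq_0)

lemma poly_op_0 [simp]: "poly_op 0 X = 0"
  by (simp add: poly_op_def)

lemma poly_op_pCons:
  "poly_op (pCons a p) X x = a *\<^sub>R x + X (poly_op p X x)"
proof -
  have "poly_op (pCons a p) X = (\<Sum>i\<le>Suc (degree p). coeff (pCons a p) i *\<^sub>R op_power X i)"
    by (rule poly_op_cover) (rule degree_pCons_le)
  also have "\<dots> = a *\<^sub>R id_blinfun + (\<Sum>i\<le>degree p. coeff p i *\<^sub>R op_power X (Suc i))"
    by (subst sum.atMost_Suc_shift) (simp add: op_power_def)
  finally show ?thesis
    by (simp add: blinfun.add_left blinfun.scaleR_left blinfun.sum_left blinfun.sum_right
        blinfun.scaleR_right op_power_def poly_op_def)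
qed

lemma poly_op_add: "poly_op (p + q) X x = poly_op p X x + poly_op q X x"
  by (induction p q arbitrary: x rule: poly_induct2)
     (simp_all add: poly_op_pCons blinfun.add_right scaleR_add_left)

lemma poly_op_smult: "poly_op (smult c p) X x = c *\<^sub>R poly_op p X x"
  by (induction p) (simp_all add: poly_op_pCons blinfun.scaleR_right scaleR_add_right)

lemma poly_op_diff: "poly_op (p - q) X = poly_op p X - poly_op q X"
proof (rule blinfun_eqI)
  fix x
  have "poly_op (p + smult (-1) q) X x = (poly_op p X - poly_op q X) x"
    by (simp only: poly_op_add poly_op_smult) (simp add: blinfun.diff_left)
  then show "poly_op (p - q) X x = (poly_op p X - poly_op q X) x" by simp
qed

lemma poly_op_mult: "poly_op (p * q) X = poly_op p X o\<^sub>L poly_op q X"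
  by (rule blinfun_eqI, induction p)
     (simp_all add: poly_op_pCons poly_op_add poly_op_smult)

lemma poly_op_const [simp]: "poly_op [:c:] X = c *\<^sub>R id_blinfun"
  by (rule blinfun_eqI) (simp add: poly_op_pCons blinfun.scaleR_left)

lemma poly_op_X [simp]: "poly_op [:0, 1:] X = X"
  by (rule blinfun_eqI) (simp add: poly_op_pCons blinfun.scaleR_left)

lemma poly_op_commute: "poly_op p X (X x) = X (poly_op p X x)"
proof -
  have "poly_op (p * [:0, 1:]) X x = poly_op ([:0, 1:] * p) X x" by (simp add: mult.commute)
  then show ?thesis by (simp only: poly_op_mult poly_op_X blinfun_apply_blinfun_compose)
qed

lemma symmetric_op_poly_op: "symmetric_op X \<Longrightarrow> symmetric_op (poly_op p X)"
  unfolding symmetric_op_def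
  by (induction p) (simp_all add: poly_op_pCons inner_add poly_op_commute)

lemma bounded_linear_scaleC: "bounded_linear (\<lambda>x::'a::complex_inner. \<i> *\<^sub>C x)"
proof (rule bounded_linear_intro[where K = 1])
  fix x y :: 'a and r :: real
  show "\<i> *\<^sub>C (x + y) = \<i> *\<^sub>C x + \<i> *\<^sub>C y" by (rule scaleC_add_right)
  show "\<i> *\<^sub>C r *\<^sub>R x = r *\<^sub>R \<i> *\<^sub>C x" by (simp add: scaleR_scaleC scaleC_scaleC mult.commute)
  have "inner (\<i> *\<^sub>C x) (\<i> *\<^sub>C x) = - inner x (\<i> *\<^sub>C \<i> *\<^sub>C x)" by (rule inner_ii)
  also have "\<i> *\<^sub>C \<i> *\<^sub>C x = (-1) *\<^sub>R x" by (simp add: scaleC_scaleC scaleR_scaleC)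
  finally have "norm (\<i> *\<^sub>C x) = norm x" by (simp add: norm_eq)
  then show "norm (\<i> *\<^sub>C x) \<le> norm x * 1" by simp
qed

lemma clinear_op_poly_op: "clinear_op X \<Longrightarrow> clinear_op (poly_op p X)"
  by (induction p)
     (auto simp: clinear_op_iff_ii poly_op_pCons scaleC_add_right scaleR_scaleC scaleC_scaleC
       linear_0[OF bounded_linear.linear[OF bounded_linear_scaleC]] mult.commute)

lemma poly_op_approx_eigenvalue:
  assumes "approx_eigenvalue X t" and "e > 0"
  obtains x where "norm x = 1" "norm (X x - t *\<^sub>R x) < e"
    "norm (poly_op q X x - poly q t *\<^sub>R x) < e"
proof -
  have "poly (q - [:poly q t:]) t = 0" by simp
  then obtain r where r: "q - [:poly q t:] = [:- t, 1:] * r"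
    by (auto simp only: poly_eq_0_iff_dvd dvd_def)
  then have "q - [:poly q t:] = r * [:- t, 1:]" by (simp only: mult.commute)
  then have r: "poly_op q X - poly q t *\<^sub>R id_blinfun = poly_op r X o\<^sub>L poly_op [:- t, 1:] X"
    by (metis poly_op_diff poly_op_const poly_op_mult)
  have r': "poly_op q X x - poly q t *\<^sub>R x = poly_op r X (X x - t *\<^sub>R x)" for x
    using arg_cong[OF r, of "\<lambda>A. blinfun_apply A x"]
    by (simp add: blinfun.diff_left blinfun.scaleR_left poly_op_pCons)
  define K where "K = norm (poly_op r X) + 1"
  have K: "K \<ge> 1" by (simp add: K_def)
  have "e / K > 0" using K assms(2) by simp
  then obtain x where x: "norm x = 1" "norm (X x - t *\<^sub>R x) < e / K"
    using assms(1) unfolding approx_eigenvalue_def by blast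
  have "norm (poly_op q X x - poly q t *\<^sub>R x) \<le> norm (poly_op r X) * norm (X x - t *\<^sub>R x)"
    unfolding r' by (rule norm_blinfun)
  also have "\<dots> \<le> K * norm (X x - t *\<^sub>R x)" unfolding K_def by (intro mult_right_mono) auto
  also have "\<dots> < e" using x(2) K by (simp add: field_simps)
  finally have *: "norm (poly_op q X x - poly q t *\<^sub>R x) < e" .
  have "e / K \<le> e / 1" using K assms(2) by (intro divide_left_mono) auto
  then show ?thesis using that[OF x(1) _ *] x(2) by simp
qed

lemma poly_of_real_mult:
  "poly (map_poly complex_of_real (p * q)) z
    = poly (map_poly complex_of_real p) z * poly (map_poly complex_of_real q) z"
proof -
  have add: "poly (map_poly complex_of_real (p + q)) z
    = poly (map_poly complex_of_real p) z + poly (map_poly complex_of_real q) z" for p q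
    by (induction p q rule: poly_induct2) (simp_all add: map_poly_pCons algebra_simps)
  have smult: "poly (map_poly complex_of_real (smult c p)) z
    = of_real c * poly (map_poly complex_of_real p) z" for c p
    by (induction p) (simp_all add: map_poly_pCons algebra_simps)
  show ?thesis
    by (induction p) (simp_all add: map_poly_pCons add smult algebra_simps)
qed

text \<open>
  The quadratic factors are the ones with the nonreal roots \<open>a \<plusminus> b \<i>\<close>.
\<close>

lemma real_poly_factor:
  fixes q :: "real poly"
  assumes "degree q > 0"
  shows "(\<exists>a r. q = [:- a, 1:] * r) \<or> (\<exists>a b r. b \<noteq> 0 \<and> q = [:a\<^sup>2 + b\<^sup>2, - 2 * a, 1:] * r)"
proof -
  let ?C = "map_poly complex_of_real"
  have "degree (?C q) > 0" using assms by (simp add: degree_map_poly)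
  then have "\<not> constant (poly (?C q))" by (simp add: constant_degree)
  then obtain z where z: "poly (?C q) z = 0" using fundamental_theorem_of_algebra by blast
  define a b where "a = Re z" "b = Im z"
  have zab: "z = Complex a b" by (simp add: a_b_def)
  show ?thesis
  proof (cases "b = 0")
    case True
    have "poly (?C q) (of_real a) = of_real (poly q a)"
      by (induction q) (simp_all add: map_poly_pCons)
    moreover have "z = of_real a" using True zab by (simp add: complex_eq_iff)
    ultimately have "poly q a = 0" using z by simp
    then show ?thesis by (auto simp only: poly_eq_0_iff_dvd dvd_def)
  next
    case False
    define m where "m = [:a\<^sup>2 + b\<^sup>2, - 2 * a, 1:]"
    have m0: "m \<noteq> 0" and dm: "degree m = 2" by (auto simp: m_def)
    have mz: "poly (?C m) z = 0"
      by (simp add: m_def map_poly_pCons zab complex_eq_iff power2_eq_square algebra_simps)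
    define r where "r = q mod m"
    have dr: "degree r \<le> 1" using degree_mod_less[OF m0, of q] dm by (auto simp: r_def)
    have qr: "r = q - q div m * m" by (simp add: r_def minus_div_mult_eq_mod)
    obtain c d where cd: "r = [:c, d:]"
    proof -
      obtain c s where s: "r = pCons c s" by (cases r) auto
      then have "degree s = 0" using dr by (auto split: if_splits)
      then obtain d where "s = [:d:]" by (rule degree_eq_zeroE)
      then show ?thesis using that s by blast
    qed
    have "poly (?C (q div m * m + r)) z = 0" using z by (simp add: r_def)
    moreover have "poly (?C (p + r)) z = poly (?C p) z + poly (?C r) z" for p r
      by (induction p r rule: poly_induct2) (simp_all add: map_poly_pCons algebra_simps)
    ultimately have "poly (?C r) z = 0" by (simp add: poly_of_real_mult mz)
    then have "c + d * a = 0 \<and> d * b = 0"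
      by (simp add: cd map_poly_pCons zab complex_eq_iff algebra_simps)
    then have "r = 0" using False cd by auto
    then have "q = m * (q div m)" using qr by (simp add: mult.commute)
    then show ?thesis using False unfolding m_def by blast
  qed
qed

text \<open>
  The polynomial is \<open>(t - a)\<^sup>2 + b\<^sup>2\<close>, whose value at \<open>X\<close> has quadratic form at least
  \<open>b\<^sup>2 \<parallel>x\<parallel>\<^sup>2\<close>.
\<close>

lemma bounded_below_op_quadratic:
  assumes sym: "symmetric_op X" and b: "b \<noteq> 0"
  shows "bounded_below_op (poly_op [:a\<^sup>2 + b\<^sup>2, - 2 * a, 1:] X)"
  unfolding bounded_below_op_def
proof (intro exI[of _ "b\<^sup>2"] conjI allI)
  show "b\<^sup>2 > 0" using b by simp
  fix x
  let ?Q = "poly_op [:a\<^sup>2 + b\<^sup>2, - 2 * a, 1:] X x"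
  have Q: "?Q = X (X x) - (2 * a) *\<^sub>R X x + (a\<^sup>2 + b\<^sup>2) *\<^sub>R x"
    by (simp add: poly_op_pCons blinfun.add_right blinfun.scaleR_right blinfun.diff_right)
  have "inner ?Q x = (norm (X x - a *\<^sub>R x))\<^sup>2 + b\<^sup>2 * (norm x)\<^sup>2"
    using sym unfolding Q symmetric_op_def
    by (simp add: power2_norm_eq_inner inner_add inner_diff inner_commute power2_eq_square[of a]
        power2_eq_square[of b] algebra_simps)
  then have "b\<^sup>2 * (norm x)\<^sup>2 \<le> inner ?Q x" by simp
  also have "\<dots> \<le> norm ?Q * norm x" by (rule norm_cauchy_schwarz)
  finally have *: "b\<^sup>2 * norm x * norm x \<le> norm ?Q * norm x"
    by (simp add: power2_eq_square[of "norm x"] mult.assoc)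
  show "b\<^sup>2 * norm x \<le> norm ?Q"
  proof (cases "x = 0")
    case False
    then show ?thesis using * by simp
  qed auto
qed

text \<open>
  The nontrivial half of the spectral mapping theorem for polynomials, for approximate
  eigenvalues and in contrapositive form, by factoring \<open>q\<close> over the reals.
\<close>

lemma bounded_below_op_poly:
  fixes X :: "'a::chilbert_space \<Rightarrow>\<^sub>L 'a"
  assumes sym: "symmetric_op X" and "q \<noteq> 0"
    and "\<And>t. poly q t = 0 \<Longrightarrow> complex_of_real t \<notin> spectrum X"
  shows "bounded_below_op (poly_op q X)"
  using assms(2,3)
proof (induction "degree q" arbitrary: q rule: less_induct)
  case less
  show ?case
  proof (cases "degree q = 0")
    case True
    then obtain c where c: "q = [:c:]" by (rule degree_eq_zeroE)
    then have "c \<noteq> 0" using less.prems by auto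
    then show ?thesis unfolding bounded_below_op_def c
      by (intro exI[of _ "\<bar>c\<bar>"]) (simp add: blinfun.scaleR_left)
  next
    case False
    have step: ?thesis if q: "q = m * r" and m: "bounded_below_op (poly_op m X)" "degree m > 0" for m r
    proof -
      have r0: "r \<noteq> 0" "m \<noteq> 0" using q less.prems(1) by auto
      then have "degree r < degree q" using m(2) by (simp add: q degree_mult_eq)
      then have "bounded_below_op (poly_op r X)" using r0 less.prems(2) less.hyps q by simp
      then show ?thesis unfolding q poly_op_mult by (intro bounded_below_op_compose m)
    qed
    from False consider (lin) a r where "q = [:- a, 1:] * r"
      | (quad) a b r where "b \<noteq> 0" "q = [:a\<^sup>2 + b\<^sup>2, - 2 * a, 1:] * r"
      using real_poly_factor[of q] by blast
    then show ?thesis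
    proof cases
      case lin
      then have "poly q a = 0" by simp
      then have "\<not> approx_eigenvalue X a" using less.prems(2) approx_eigenvalue_in_spectrum by blast
      moreover have "poly_op [:- a, 1:] X = X - a *\<^sub>R id_blinfun"
        by (rule blinfun_eqI) (simp add: poly_op_pCons blinfun.diff_left blinfun.scaleR_left)
      ultimately show ?thesis by (intro step[OF lin]) (auto simp: approx_eigenvalue_iff)
    next
      case quad
      then show ?thesis by (intro step[OF quad(2)] bounded_below_op_quadratic sym) auto
    qed
  qed
qed

text \<open>
  The estimate \<open>\<parallel>q(X)\<parallel> \<le> sup |q|\<close>, with the supremum over the real spectrum, on which the
  functional calculus rests: \<open>\<parallel>q(X)\<parallel>\<close> or its negative is an approximate eigenvalue of \<open>q(X)\<close>,
  hence a value of \<open>q\<close> on the spectrum.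
\<close>

lemma norm_poly_op_le:
  fixes X :: "'a::chilbert_space \<Rightarrow>\<^sub>L 'a"
  assumes sym: "symmetric_op X" and c: "c \<ge> 0"
    and le: "\<And>t. complex_of_real t \<in> spectrum X \<Longrightarrow> \<bar>poly q t\<bar> \<le> c"
  shows "norm (poly_op q X) \<le> c"
proof (cases "\<exists>e::'a. norm e = 1")
  case False
  have "x = 0" for x :: 'a
  proof (rule ccontr)
    assume "x \<noteq> 0"
    then have "norm ((1 / norm x) *\<^sub>R x) = 1" by simp
    then show False using False by blast
  qed
  then have "poly_op q X = 0" by (intro blinfun_eqI) metis
  then show ?thesis using c by simp
next
  case True
  then obtain e :: 'a where e: "norm e = 1" by blast
  obtain s where s: "\<bar>s\<bar> = norm (poly_op q X)" "approx_eigenvalue (poly_op q X) s"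
    using symmetric_op_norm_approx_eigenvalue[OF symmetric_op_poly_op[OF sym] e, of q]
    by (metis abs_minus_cancel abs_norm_cancel)
  \<comment> \<open>A point of the spectrum is needed in case \<open>q\<close> is the constant \<open>s\<close>.\<close>
  obtain t where t: "complex_of_real t \<in> spectrum X"
    using symmetric_op_norm_approx_eigenvalue[OF sym e] approx_eigenvalue_in_spectrum by blast
  have "\<not> bounded_below_op (poly_op (q - [:s:]) X)"
    using s(2) by (simp add: approx_eigenvalue_iff poly_op_diff)
  then consider "q - [:s:] = 0"
    | u where "poly (q - [:s:]) u = 0" "complex_of_real u \<in> spectrum X"
    using bounded_below_op_poly[OF sym] by blast
  then show ?thesis
  proof cases
    case 1
    then have "poly q t = s" by simp
    then show ?thesis using le[OF t] s(1) by simp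
  next
    case 2
    then have "poly q u = s" by simp
    then show ?thesis using le[OF 2(2)] s(1) by simp
  qed
qed

section \<open>The continuous functional calculus\<close>

text \<open>
  The limit of \<open>q\<^sub>n(X)\<close> exists and does not depend on the choice of the polynomials, so that
  \<^const>\<open>cfc\<close> is well defined.
\<close>

lemma cfc_tendsto:
  fixes X :: "'a::chilbert_space \<Rightarrow>\<^sub>L 'a"
  assumes sym: "symmetric_op X"
    and q: "uniform_limit {t. complex_of_real t \<in> spectrum X} (\<lambda>n. poly (q n)) f sequentially"
  shows "(\<lambda>n. poly_op (q n) X) \<longlonglongrightarrow> cfc f X"
proof -
  let ?S = "{t. complex_of_real t \<in> spectrum X}"
  have close: "\<exists>N. \<forall>m\<ge>N. \<forall>n\<ge>N. norm (poly_op (u m) X - poly_op (v n) X) < e"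
    if u: "uniform_limit ?S (\<lambda>n. poly (u n)) f sequentially"
      and v: "uniform_limit ?S (\<lambda>n. poly (v n)) f sequentially" and e: "e > 0" for u v e
  proof -
    obtain M where M: "\<And>n t. n \<ge> M \<Longrightarrow> t \<in> ?S \<Longrightarrow> dist (poly (u n) t) (f t) < e / 3"
      using u e unfolding uniform_limit_sequentially_iff by (meson divide_pos_pos zero_less_numeral)
    obtain N where N: "\<And>n t. n \<ge> N \<Longrightarrow> t \<in> ?S \<Longrightarrow> dist (poly (v n) t) (f t) < e / 3"
      using v e unfolding uniform_limit_sequentially_iff by (meson divide_pos_pos zero_less_numeral)
    have "norm (poly_op (u m) X - poly_op (v n) X) < e" if "m \<ge> max M N" "n \<ge> max M N" for m n
    proof -
      have "norm (poly_op (u m - v n) X) \<le> 2 * e / 3"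
      proof (rule norm_poly_op_le[OF sym])
        fix t assume "complex_of_real t \<in> spectrum X"
        then have "\<bar>poly (u m) t - f t\<bar> < e / 3" "\<bar>poly (v n) t - f t\<bar> < e / 3"
          using M[of m t] N[of n t] that by (simp_all add: dist_real_def)
        then show "\<bar>poly (u m - v n) t\<bar> \<le> 2 * e / 3"
          unfolding poly_diff by linarith
      qed (use e in simp)
      then show ?thesis using e by (simp add: poly_op_diff)
    qed
    then show ?thesis by blast
  qed
  have "Cauchy (\<lambda>n. poly_op (q n) X)"
    using close[OF q q] by (auto simp: Cauchy_def dist_norm)
  then obtain Y where Y: "(\<lambda>n. poly_op (q n) X) \<longlonglongrightarrow> Y"
    using Cauchy_convergent convergent_def by blast
  have "cfc f X = Y"
    unfolding cfc_def
  proof (rule the_equality)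
    fix Z assume "\<exists>q. uniform_limit ?S (\<lambda>n. poly (q n)) f sequentially \<and> (\<lambda>n. poly_op (q n) X) \<longlonglongrightarrow> Z"
    then obtain r where r: "uniform_limit ?S (\<lambda>n. poly (r n)) f sequentially"
      "(\<lambda>n. poly_op (r n) X) \<longlonglongrightarrow> Z" by blast
    have "(\<lambda>n. poly_op (q n) X - poly_op (r n) X) \<longlonglongrightarrow> 0"
      using close[OF q r(1)] by (fastforce simp: LIMSEQ_iff)
    moreover have "(\<lambda>n. poly_op (q n) X - poly_op (r n) X) \<longlonglongrightarrow> Y - Z"
      by (intro tendsto_intros Y r(2))
    ultimately show "Z = Y" using LIMSEQ_unique by fastforce
  qed (use q Y in blast)
  then show ?thesis using Y by simp
qed

lemma uniform_limit_real_polynomials: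
  fixes h :: "real \<Rightarrow> real"
  assumes "compact S" "continuous_on S h"
  obtains q where "uniform_limit S (\<lambda>n. poly (q n)) h sequentially"
proof -
  have "\<exists>p. \<forall>x\<in>S. \<bar>h x - poly p x\<bar> < 1 / real (Suc n)" for n
  proof -
    obtain g where g: "real_polynomial_function g" "\<And>x. x \<in> S \<Longrightarrow> \<bar>h x - g x\<bar> < 1 / real (Suc n)"
      using Stone_Weierstrass_real_polynomial_function[OF assms, of "1 / real (Suc n)"] by auto
    obtain a k where "g = (\<lambda>x. \<Sum>i\<le>k. a i * x ^ i)"
      using g(1) real_polynomial_function_iff_sum by blast
    then have "g = poly (\<Sum>i\<le>k. monom (a i) i)"
      by (auto simp: poly_sum poly_monom)
    then show ?thesis using g(2) by metis
  qed
  then obtain q where q: "\<And>n x. x \<in> S \<Longrightarrow> \<bar>h x - poly (q n) x\<bar> < 1 / real (Suc n)" by metis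
  have "uniform_limit S (\<lambda>n. poly (q n)) h sequentially"
    unfolding uniform_limit_sequentially_iff
  proof (intro allI impI)
    fix e :: real assume "e > 0"
    then obtain N where N: "1 / real (Suc N) < e" using nat_approx_posE by blast
    have "dist (poly (q n) x) (h x) < e" if "n \<ge> N" "x \<in> S" for n x
    proof -
      have "1 / real (Suc n) \<le> 1 / real (Suc N)" using that by (simp add: frac_le)
      then show ?thesis using q[OF that(2), of n] N by (simp add: dist_real_def)
    qed
    then show "\<exists>N. \<forall>n\<ge>N. \<forall>x\<in>S. dist (poly (q n) x) (h x) < e" by blast
  qed
  then show ?thesis using that by blast
qed

text \<open>
  For positive \<open>X\<close> and \<open>h\<close> continuous on the half-line, polynomials converging on all of
  \<open>[0, \<parallel>X\<parallel>]\<close> can be used; this interval contains the spectrum.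
\<close>

lemma cfc_polynomial_limit:
  fixes X :: "'a::chilbert_space \<Rightarrow>\<^sub>L 'a"
  assumes pos: "positive_op X" and h: "continuous_on {0..} h"
  obtains q where "uniform_limit {0..norm X} (\<lambda>n. poly (q n)) h sequentially"
    "(\<lambda>n. poly_op (q n) X) \<longlonglongrightarrow> cfc h X"
proof -
  have "continuous_on {0..norm X} h" using h continuous_on_subset by fastforce
  then obtain q where q: "uniform_limit {0..norm X} (\<lambda>n. poly (q n)) h sequentially"
    using uniform_limit_real_polynomials[of "{0..norm X}" h] by auto
  have "(\<lambda>n. poly_op (q n) X) \<longlonglongrightarrow> cfc h X"
    using pos by (intro cfc_tendsto uniform_limit_on_subset[OF q] spectrum_positive_op)
      (auto simp: positive_op_def)
  then show ?thesis using that q by blast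
qed

lemma symmetric_op_limit:
  assumes "\<And>n. symmetric_op (A n)" and "A \<longlonglongrightarrow> B"
  shows "symmetric_op B"
  unfolding symmetric_op_def
proof (intro allI)
  fix x y
  have "(\<lambda>n. inner (A n x) y) \<longlonglongrightarrow> inner (B x) y" "(\<lambda>n. inner x (A n y)) \<longlonglongrightarrow> inner x (B y)"
    by (intro tendsto_intros blinfun.tendsto assms(2))+
  then show "inner (B x) y = inner x (B y)"
    using assms(1) LIMSEQ_unique unfolding symmetric_op_def by fastforce
qed

lemma clinear_op_limit:
  assumes "\<And>n. clinear_op (A n)" and "A \<longlonglongrightarrow> B"
  shows "clinear_op B"
  unfolding clinear_op_iff_ii
proof (intro allI)
  fix x
  have "(\<lambda>n. A n (\<i> *\<^sub>C x)) \<longlonglongrightarrow> B (\<i> *\<^sub>C x)"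
    by (intro blinfun.tendsto assms(2) tendsto_intros)
  moreover have "(\<lambda>n. \<i> *\<^sub>C A n x) \<longlonglongrightarrow> \<i> *\<^sub>C B x"
    by (intro bounded_linear.tendsto[OF bounded_linear_scaleC] blinfun.tendsto assms(2) tendsto_intros)
  ultimately show "B (\<i> *\<^sub>C x) = \<i> *\<^sub>C B x"
    using assms(1) LIMSEQ_unique unfolding clinear_op_iff_ii by fastforce
qed

lemma symmetric_op_cfc:
  assumes "positive_op X" "continuous_on {0..} h"
  shows "symmetric_op (cfc h X)"
  by (rule cfc_polynomial_limit[OF assms], rule symmetric_op_limit)
     (use assms in \<open>auto simp: positive_op_def intro: symmetric_op_poly_op\<close>)

lemma clinear_op_cfc:
  assumes "positive_op X" "continuous_on {0..} h" "clinear_op X"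
  shows "clinear_op (cfc h X)"
  by (rule cfc_polynomial_limit[OF assms(1,2)], rule clinear_op_limit)
     (use assms in \<open>auto intro: clinear_op_poly_op\<close>)

lemma cfc_cong:
  assumes "\<And>t. complex_of_real t \<in> spectrum X \<Longrightarrow> h t = k t"
  shows "cfc h X = cfc k X"
proof -
  have "uniform_limit {t. complex_of_real t \<in> spectrum X} (\<lambda>n. poly (q n)) h sequentially
    \<longleftrightarrow> uniform_limit {t. complex_of_real t \<in> spectrum X} (\<lambda>n. poly (q n)) k sequentially" for q
    by (rule uniform_limit_cong') (use assms in auto)
  then show ?thesis unfolding cfc_def by simp
qed

lemma cfc_ident:
  assumes "symmetric_op X"
  shows "cfc (\<lambda>t. t) X = X"
proof -
  have "(\<lambda>n::nat. poly_op [:0, 1:] X) \<longlonglongrightarrow> cfc (\<lambda>t. t) X"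
    by (rule cfc_tendsto[OF assms]) (simp add: uniform_limit_iff)
  then show ?thesis by (simp add: LIMSEQ_const_iff)
qed

lemma cfc_square:
  fixes X :: "'a::chilbert_space \<Rightarrow>\<^sub>L 'a"
  assumes pos: "positive_op X" and h: "continuous_on {0..} h"
  shows "cfc (\<lambda>t. h t * h t) X = cfc h X o\<^sub>L cfc h X"
proof -
  obtain q where q: "uniform_limit {0..norm X} (\<lambda>n. poly (q n)) h sequentially"
    and Y: "(\<lambda>n. poly_op (q n) X) \<longlonglongrightarrow> cfc h X"
    using cfc_polynomial_limit[OF assms] by blast
  have "continuous_on {0..norm X} h" using h continuous_on_subset by fastforce
  then have "bounded (h ` {0..norm X})"
    by (intro compact_imp_bounded compact_continuous_image) auto
  then have "uniform_limit {0..norm X} (\<lambda>n t. poly (q n) t * poly (q n) t) (\<lambda>t. h t * h t) sequentially"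
    by (intro uniform_lim_mult q)
  then have u: "uniform_limit {0..norm X} (\<lambda>n. poly (q n * q n)) (\<lambda>t. h t * h t) sequentially"
    by (subst uniform_limit_cong'[of _ _ "\<lambda>n t. poly (q n) t * poly (q n) t"]) auto
  have sym: "symmetric_op X" using pos by (simp add: positive_op_def)
  have "(\<lambda>n. poly_op (q n * q n) X) \<longlonglongrightarrow> cfc (\<lambda>t. h t * h t) X"
    by (rule cfc_tendsto[OF sym uniform_limit_on_subset[OF u spectrum_positive_op[OF pos]]])
  moreover have "(\<lambda>n. poly_op (q n * q n) X) \<longlonglongrightarrow> (cfc h X o\<^sub>L cfc h X)"
    unfolding poly_op_mult
    by (intro bounded_bilinear.tendsto[OF bounded_bilinear_blinfun_compose] Y)
  ultimately show ?thesis using LIMSEQ_unique by blast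
qed

lemma positive_op_cfc:
  fixes X :: "'a::chilbert_space \<Rightarrow>\<^sub>L 'a"
  assumes pos: "positive_op X" and h: "continuous_on {0..} h" and h0: "\<And>t. t \<ge> 0 \<Longrightarrow> h t \<ge> 0"
  shows "positive_op (cfc h X)"
proof -
  \<comment> \<open>\<open>h(X)\<close> is the square of the symmetric operator given by the square root of \<open>h\<close>.\<close>
  have s: "continuous_on {0..} (\<lambda>t. sqrt (h t))" by (intro continuous_intros h)
  have "cfc h X = cfc (\<lambda>t. sqrt (h t) * sqrt (h t)) X"
    by (rule cfc_cong) (use spectrum_positive_op[OF pos] h0 in force)
  also have "\<dots> = cfc (\<lambda>t. sqrt (h t)) X o\<^sub>L cfc (\<lambda>t. sqrt (h t)) X"
    by (rule cfc_square[OF pos s])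
  finally have eq: "cfc h X = cfc (\<lambda>t. sqrt (h t)) X o\<^sub>L cfc (\<lambda>t. sqrt (h t)) X" .
  have "inner (cfc h X x) x = inner (cfc (\<lambda>t. sqrt (h t)) X x) (cfc (\<lambda>t. sqrt (h t)) X x)" for x
    using symmetric_op_cfc[OF pos s] unfolding eq symmetric_op_def by simp
  then show ?thesis using symmetric_op_cfc[OF pos h] by (simp add: positive_op_def)
qed

text \<open>
  Spectral mapping for approximate eigenvalues: the same unit vectors work for \<open>q(X)\<close> with any
  polynomial \<open>q\<close>, hence for \<open>h(X)\<close>.
\<close>

lemma approx_eigenvalue_cfc:
  fixes X :: "'a::chilbert_space \<Rightarrow>\<^sub>L 'a"
  assumes pos: "positive_op X" and h: "continuous_on {0..} h" and t: "approx_eigenvalue X t"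
  shows "approx_eigenvalue (cfc h X) (h t)"
  unfolding approx_eigenvalue_def
proof (intro allI impI)
  fix e :: real assume e: "e > 0"
  obtain q where q: "uniform_limit {0..norm X} (\<lambda>n. poly (q n)) h sequentially"
    and Y: "(\<lambda>n. poly_op (q n) X) \<longlonglongrightarrow> cfc h X"
    using cfc_polynomial_limit[OF pos h] by blast
  have "t \<in> {0..norm X}"
    using approx_eigenvalue_in_spectrum[OF t] spectrum_positive_op[OF pos] by blast
  then have "(\<lambda>n. poly (q n) t) \<longlonglongrightarrow> h t" using q by (rule tendsto_uniform_limitI[rotated])
  then have "\<forall>\<^sub>F n in sequentially. dist (poly (q n) t) (h t) < e / 3"
    using e by (intro tendstoD) auto
  moreover have "\<forall>\<^sub>F n in sequentially. dist (poly_op (q n) X) (cfc h X) < e / 3"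
    using e Y by (intro tendstoD) auto
  ultimately have "\<forall>\<^sub>F n in sequentially. dist (poly (q n) t) (h t) < e / 3
      \<and> dist (poly_op (q n) X) (cfc h X) < e / 3" by eventually_elim blast
  then obtain n where n: "\<bar>poly (q n) t - h t\<bar> < e / 3" "norm (poly_op (q n) X - cfc h X) < e / 3"
    unfolding eventually_sequentially by (auto simp: dist_norm)
  obtain x where x: "norm x = 1" "norm (poly_op (q n) X x - poly (q n) t *\<^sub>R x) < e / 3"
    using poly_op_approx_eigenvalue[OF t, of "e / 3" "q n"] e by auto
  have "cfc h X x - h t *\<^sub>R x = (poly_op (q n) X x - poly (q n) t *\<^sub>R x)
      - (poly_op (q n) X - cfc h X) x + (poly (q n) t - h t) *\<^sub>R x"
    by (simp add: blinfun.diff_left scaleR_diff_left)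
  also have "norm \<dots> \<le> norm (poly_op (q n) X x - poly (q n) t *\<^sub>R x)
      + norm ((poly_op (q n) X - cfc h X) x) + norm ((poly (q n) t - h t) *\<^sub>R x)"
    by (meson norm_triangle_ineq norm_triangle_ineq4 add_mono order_refl order_trans)
  also have "\<dots> < e"
    using norm_blinfun[of "poly_op (q n) X - cfc h X" x] x n by simp
  finally show "\<exists>x. norm x = 1 \<and> norm (cfc h X x - h t *\<^sub>R x) < e" using x(1) by blast
qed

section \<open>The modulus of an operator\<close>

lemma
  assumes T: "clinear_op T"
  shows positive_op_adj_compose: "positive_op (adj T o\<^sub>L T)"
    and clinear_op_adj_compose: "clinear_op (adj T o\<^sub>L T)"
  using T clinear_adj[OF T]
  by (auto simp: positive_op_def symmetric_op_def inner_adj_right[OF T] inner_commute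
      inner_adj[OF T, symmetric] clinear_op_def)

lemma continuous_on_sqrt_nonneg: "continuous_on {0..} sqrt"
  by (intro continuous_intros)

lemma positive_op_sqrt:
  fixes X :: "'a::chilbert_space \<Rightarrow>\<^sub>L 'a"
  assumes "positive_op X"
  shows "cfc sqrt X o\<^sub>L cfc sqrt X = X"
proof -
  have "cfc sqrt X o\<^sub>L cfc sqrt X = cfc (\<lambda>t. sqrt t * sqrt t) X"
    by (rule cfc_square[symmetric, OF assms continuous_on_sqrt_nonneg])
  also have "\<dots> = cfc (\<lambda>t. t) X"
    by (rule cfc_cong) (use spectrum_positive_op[OF assms] in force)
  also have "\<dots> = X" using assms by (simp add: cfc_ident positive_op_def)
  finally show ?thesis .
qed

lemma
  assumes T: "clinear_op T"
  shows positive_op_abs_op: "positive_op (abs_op T)"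
    and clinear_op_abs_op: "clinear_op (abs_op T)"
    and abs_op_square: "abs_op T o\<^sub>L abs_op T = adj T o\<^sub>L T"
  unfolding abs_op_def using positive_op_adj_compose[OF T] clinear_op_adj_compose[OF T]
  by (auto intro!: positive_op_cfc clinear_op_cfc positive_op_sqrt continuous_on_sqrt_nonneg)

lemma norm_abs_op_apply:
  assumes T: "clinear_op T"
  shows "norm (abs_op T x) = norm (T x)"
proof -
  have "inner (abs_op T x) (abs_op T x) = inner ((abs_op T o\<^sub>L abs_op T) x) x"
    using positive_op_abs_op[OF T] by (simp add: positive_op_def symmetric_op_def)
  also have "\<dots> = inner (T x) (T x)"
    by (simp add: abs_op_square[OF T] inner_adj_right[OF T])
  finally show ?thesis by (simp add: norm_eq)
qed

lemma approx_eigenvalue_abs_op: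
  fixes T :: "'a::chilbert_space \<Rightarrow>\<^sub>L 'a"
  assumes T: "clinear_op T" and e: "norm (e::'a) = 1"
  shows "approx_eigenvalue (abs_op T) (norm T)"
proof -
  have "approx_eigenvalue (adj T o\<^sub>L T) ((norm T)\<^sup>2)"
    by (rule approx_eigenvalue_adjoint_square[OF inner_adj[OF T] norm_adj_le[OF T] e])
  from approx_eigenvalue_cfc[OF positive_op_adj_compose[OF T] continuous_on_sqrt_nonneg this]
  show ?thesis by (simp add: abs_op_def)
qed

section \<open>The two norm estimates\<close>

lemma positive_op_cauchy_schwarz:
  fixes A :: "'a::chilbert_space \<Rightarrow>\<^sub>L 'a"
  assumes A: "positive_op A"
  shows "(inner (A x) y)\<^sup>2 \<le> inner (A x) x * inner (A y) y"
proof -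
  let ?R = "cfc sqrt A"
  have "symmetric_op ?R" by (rule symmetric_op_cfc[OF A continuous_on_sqrt_nonneg])
  then have "inner (A u) v = inner (?R u) (?R v)" for u v
    by (subst positive_op_sqrt[OF A, symmetric]) (simp add: symmetric_op_def)
  then show ?thesis by (simp add: Cauchy_Schwarz_ineq)
qed

text \<open>
  Since \<open>A S\<close> is symmetric, its norm is the supremum of its quadratic form on unit vectors, and
  the Cauchy--Schwarz inequality for the form of \<open>A\<close> gives
  \<open>\<langle>A S x, x\<rangle>\<^sup>2 \<le> \<langle>A S x, S x\<rangle> \<langle>A x, x\<rangle> = \<langle>A S\<^sup>2 x, x\<rangle> \<langle>A x, x\<rangle> \<le> \<parallel>A\<parallel>\<^sup>2 \<parallel>S\<^sup>2\<parallel>\<close>.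
\<close>

lemma norm_symmetrized_product_le:
  fixes A S :: "'a::chilbert_space \<Rightarrow>\<^sub>L 'a"
  assumes A: "positive_op A" and S: "clinear_op S" and eq: "A o\<^sub>L S = adj S o\<^sub>L A"
    and e: "norm (e::'a) = 1"
  shows "norm (A o\<^sub>L S) \<le> norm A * sqrt (norm (S o\<^sub>L S))"
proof -
  let ?C = "norm A * sqrt (norm (S o\<^sub>L S))"
  have sA: "inner (A x) y = inner x (A y)" for x y
    using A by (simp add: positive_op_def symmetric_op_def)
  have AS: "A (S x) = adj S (A x)" for x
    using arg_cong[OF eq, of "\<lambda>B. blinfun_apply B x"] by simp
  have form: "\<bar>inner (A (S x)) x\<bar> \<le> ?C" if x: "norm x = 1" for x
  proof -
    have "inner (A (S x)) (S x) = inner (A (S (S x))) x"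
      using AS[of "S x"] by (simp add: inner_adj_right[OF S])
    also have "\<dots> \<le> norm (A ((S o\<^sub>L S) x))"
      using norm_cauchy_schwarz[of "A (S (S x))" x] x by simp
    also have "\<dots> \<le> norm A * norm ((S o\<^sub>L S) x)" by (rule norm_blinfun)
    also have "\<dots> \<le> norm A * norm (S o\<^sub>L S)"
      using norm_blinfun[of "S o\<^sub>L S" x] x by (intro mult_left_mono) auto
    finally have 1: "inner (A (S x)) (S x) \<le> norm A * norm (S o\<^sub>L S)" .
    have 2: "inner (A x) x \<le> norm A"
      using norm_cauchy_schwarz[of "A x" x] norm_blinfun[of A x] x by simp
    have "(inner (A (S x)) x)\<^sup>2 \<le> inner (A (S x)) (S x) * inner (A x) x"
      by (rule positive_op_cauchy_schwarz[OF A])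
    also have "\<dots> \<le> (norm A * norm (S o\<^sub>L S)) * norm A"
      using A by (intro mult_mono 1 2) (auto simp: positive_op_def)
    also have "\<dots> = ?C\<^sup>2" by (simp add: power_mult_distrib power2_eq_square)
    finally have "\<bar>inner (A (S x)) x\<bar>\<^sup>2 \<le> ?C\<^sup>2" by simp
    then show ?thesis by (rule power2_le_imp_le) simp
  qed
  have "symmetric_op (A o\<^sub>L S)"
    unfolding symmetric_op_def by (simp add: AS inner_adj_right[OF S] sA)
  then obtain s where s: "\<bar>s\<bar> = norm (A o\<^sub>L S)" "approx_eigenvalue (A o\<^sub>L S) s"
    using symmetric_op_norm_approx_eigenvalue[OF _ e, of "A o\<^sub>L S"]
    by (metis abs_minus_cancel abs_norm_cancel)
  show ?thesis
  proof (rule field_le_epsilon)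
    fix d :: real assume "d > 0"
    then obtain x where x: "norm x = 1" "norm (A (S x) - s *\<^sub>R x) < d"
      using s(2) unfolding approx_eigenvalue_def by auto
    have "s = inner (A (S x)) x - inner (A (S x) - s *\<^sub>R x) x"
      using x(1) by (simp add: inner_diff dot_square_norm)
    moreover have "\<bar>inner (A (S x) - s *\<^sub>R x) x\<bar> \<le> d"
      using Cauchy_Schwarz_ineq2[of "A (S x) - s *\<^sub>R x" x] x by simp
    ultimately show "norm (A o\<^sub>L S) \<le> ?C + d" using form[OF x(1)] s(1) by linarith
  qed
qed

lemma continuous_on_powr_nonneg: "r > 0 \<Longrightarrow> continuous_on {0..} (\<lambda>t::real. t powr r)"
  by (rule continuous_on_powr') (auto intro: continuous_intros)

lemma ell_nonpos:
  assumes "approx_eigenvalue X 0"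
  shows "ell X \<le> 0"
proof (rule field_le_epsilon)
  fix d :: real assume "d > 0"
  then obtain x where x: "norm x = 1" "norm (X x) < d"
    using assms unfolding approx_eigenvalue_def by auto
  have "ell X \<le> norm (X x)"
    unfolding ell_def by (rule cInf_lower) (use x in \<open>auto intro: bdd_belowI[of _ 0]\<close>)
  then show "ell X \<le> 0 + d" using x(2) by simp
qed

text \<open>
  Each bracket of the inequality, with its exponent, is at least \<open>\<parallel>F\<parallel>\<close>: as \<open>\<parallel>F\<parallel>\<close> is an approximate eigenvalue of
  \<open>F\<close>, the operator \<open>F\<^sup>2 - \<parallel>F\<parallel>\<^sup>2\<close> is not bounded below, and neither is the \<open>p\<close>-th power of
  its modulus, so the subtracted term \<^const>\<open>ell\<close> is not positive.
\<close>

lemma norm_le_refined_factor: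
  fixes F :: "'a::chilbert_space \<Rightarrow>\<^sub>L 'a"
  assumes F: "positive_op F" "clinear_op F" and p: "p > 0" and e: "norm (e::'a) = 1"
  shows "norm F \<le> ((norm (op_powr F p))\<^sup>2
    - ell (op_powr (abs_op (op_powr F 2 - (norm F)\<^sup>2 *\<^sub>R id_blinfun)) p)) powr (1 / (2 * p))"
proof -
  let ?l = "norm F"
  have eig: "approx_eigenvalue F ?l" by (rule positive_op_norm_approx_eigenvalue[OF F(1) e])
  have powr: "approx_eigenvalue (op_powr F r) (?l powr r)" if "r > 0" for r
    unfolding op_powr_def by (rule approx_eigenvalue_cfc[OF F(1) continuous_on_powr_nonneg[OF that] eig])
  define G where "G = op_powr F 2 - ?l\<^sup>2 *\<^sub>R id_blinfun"
  have c2: "continuous_on {0..} (\<lambda>t::real. t powr 2)" by (rule continuous_on_powr_nonneg) simp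
  have sG: "symmetric_op G" and cG: "clinear_op G"
    using symmetric_op_cfc[OF F(1) c2] clinear_op_cfc[OF F(1) c2 F(2)]
    unfolding G_def op_powr_def symmetric_op_def clinear_op_iff_ii
    by (auto simp: blinfun.diff_left blinfun.scaleR_left inner_diff
        linear_diff[OF bounded_linear.linear[OF bounded_linear_scaleC]]
        linear_cmul[OF bounded_linear.linear[OF bounded_linear_scaleC]])
  have "approx_eigenvalue (op_powr F 2) (?l\<^sup>2)" using powr[of 2] by simp
  then have "approx_eigenvalue G 0"
    unfolding approx_eigenvalue_def G_def by (simp add: blinfun.diff_left blinfun.scaleR_left)
  then have "approx_eigenvalue (G o\<^sub>L G) 0" using approx_eigenvalue_square by fastforce
  moreover have "adj G = G" using sG by (intro adj_unique[OF cG]) (simp add: symmetric_op_def)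
  ultimately have "approx_eigenvalue (abs_op G) (sqrt 0)"
    unfolding abs_op_def using positive_op_adj_compose[OF cG]
    by (intro approx_eigenvalue_cfc continuous_on_sqrt_nonneg) auto
  then have "approx_eigenvalue (op_powr (abs_op G) p) (0 powr p)"
    unfolding op_powr_def
    by (intro approx_eigenvalue_cfc[OF positive_op_abs_op[OF cG] continuous_on_powr_nonneg[OF p]]) simp
  then have ell: "ell (op_powr (abs_op G) p) \<le> 0" by (intro ell_nonpos) simp
  have "?l powr p \<le> norm (op_powr F p)" using norm_ge_approx_eigenvalue[OF powr[OF p]] by simp
  then have "(?l powr p)\<^sup>2 \<le> (norm (op_powr F p))\<^sup>2" by (intro power_mono) auto
  then have "?l powr (2 * p) \<le> (norm (op_powr F p))\<^sup>2 - ell (op_powr (abs_op G) p)"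
    using ell by (simp add: power2_eq_square flip: powr_add)
  then have "(?l powr (2 * p)) powr (1 / (2 * p))
      \<le> ((norm (op_powr F p))\<^sup>2 - ell (op_powr (abs_op G) p)) powr (1 / (2 * p))"
    using p by (intro powr_mono2) auto
  moreover have "(?l powr (2 * p)) powr (1 / (2 * p)) = ?l" using p by (simp add: powr_powr)
  ultimately show ?thesis by (simp add: G_def)
qed

lemma numerical_radius_le:
  fixes X :: "'a::complex_inner \<Rightarrow>\<^sub>L 'a"
  assumes "0 \<le> b" and "\<And>x. norm x = 1 \<Longrightarrow> cmod (cinner (X x) x) \<le> b"
  shows "numerical_radius X \<le> b"
  unfolding numerical_radius_def by (rule cSup_least) (use assms in auto)

section \<open>The numerical radius inequality\<close>

theorem theorem1:
  fixes T S :: "'a::chilbert_space \<Rightarrow>\<^sub>L 'a"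
    and f g :: "real \<Rightarrow> real"
    and p :: real
  assumes "clinear_op T" and "clinear_op S"
    and "abs_op T o\<^sub>L S = adj S o\<^sub>L abs_op T"
    and "continuous_on {0..} f" and "continuous_on {0..} g"
    and "\<And>t. t \<ge> 0 \<Longrightarrow> f t \<ge> 0" and "\<And>t. t \<ge> 0 \<Longrightarrow> g t \<ge> 0"
    and "\<And>t. t \<ge> 0 \<Longrightarrow> f t * g t = t"
    and "p \<ge> 2"
  shows "numerical_radius (T o\<^sub>L S)
    \<le> 1/2 * (norm S + norm (S o\<^sub>L S) powr (1/2))
      * ((norm (op_powr (cfc f (abs_op T)) p))\<^sup>2
          - ell (op_powr (abs_op (op_powr (cfc f (abs_op T)) 2
                   - (norm (cfc f (abs_op T)))\<^sup>2 *\<^sub>R id_blinfun)) p)) powr (1 / (2 * p))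
      * ((norm (op_powr (cfc g (abs_op (adj T))) p))\<^sup>2
          - ell (op_powr (abs_op (op_powr (cfc g (abs_op (adj T))) 2
                   - (norm (cfc g (abs_op (adj T))))\<^sup>2 *\<^sub>R id_blinfun)) p)) powr (1 / (2 * p))"
    (is "_ \<le> 1/2 * ?s * ?F * ?G")
proof (rule numerical_radius_le)
  show "0 \<le> 1/2 * ?s * ?F * ?G" by simp
  fix x :: 'a assume x: "norm x = 1"
  note T = assms(1) and S = assms(2) and T' = clinear_adj[OF assms(1)]
  \<comment> \<open>\<open>\<parallel>U\<parallel>\<close> is an approximate eigenvalue of \<open>|U|\<close>, so \<open>h(\<parallel>U\<parallel>) \<le> \<parallel>h(|U|)\<parallel>\<close>.\<close>
  have factor: "h (norm U) \<le> ((norm (op_powr (cfc h (abs_op U)) p))\<^sup>2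
      - ell (op_powr (abs_op (op_powr (cfc h (abs_op U)) 2
                   - (norm (cfc h (abs_op U)))\<^sup>2 *\<^sub>R id_blinfun)) p)) powr (1 / (2 * p))"
    if U: "clinear_op U" and h: "continuous_on {0..} h" "\<And>t. t \<ge> 0 \<Longrightarrow> h t \<ge> 0"
    for U :: "'a \<Rightarrow>\<^sub>L 'a" and h
  proof -
    have "h (norm U) \<le> norm (cfc h (abs_op U))"
      using norm_ge_approx_eigenvalue[OF approx_eigenvalue_cfc[OF positive_op_abs_op[OF U] h(1)
            approx_eigenvalue_abs_op[OF U x]]] by simp
    also have "\<dots> \<le> ((norm (op_powr (cfc h (abs_op U)) p))\<^sup>2
      - ell (op_powr (abs_op (op_powr (cfc h (abs_op U)) 2
                   - (norm (cfc h (abs_op U)))\<^sup>2 *\<^sub>R id_blinfun)) p)) powr (1 / (2 * p))"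
      using assms(9) h U
      by (intro norm_le_refined_factor[OF _ _ _ x] positive_op_cfc clinear_op_cfc
          positive_op_abs_op clinear_op_abs_op) auto
    finally show ?thesis .
  qed
  have F: "f (norm T) \<le> ?F" by (rule factor[OF T assms(4,6)])
  have G: "g (norm T) \<le> ?G" using factor[OF T' assms(5,7)] by (simp add: norm_adj[OF T])
  have "norm T = f (norm T) * g (norm T)" using assms(8) by simp
  also have "\<dots> \<le> ?F * ?G" using F G assms(6,7) by (intro mult_mono) auto
  finally have FG: "norm T \<le> ?F * ?G" .
  have "norm (S o\<^sub>L S) \<le> (norm S)\<^sup>2"
    using norm_blinfun_compose[of S S] by (simp add: power2_eq_square)
  then have "sqrt (norm (S o\<^sub>L S)) \<le> norm S" by (simp add: real_le_lsqrt)
  then have s: "sqrt (norm (S o\<^sub>L S)) \<le> 1/2 * ?s" by (simp add: powr_half_sqrt)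
  have nA: "norm (abs_op T) \<le> norm T"
    by (rule norm_blinfun_bound) (auto simp: norm_abs_op_apply[OF T] norm_blinfun)
  have "cmod (cinner ((T o\<^sub>L S) x) x) \<le> norm (T (S x))"
    using norm_cinner_le[of "T (S x)" x] x by simp
  also have "\<dots> = norm ((abs_op T o\<^sub>L S) x)" by (simp add: norm_abs_op_apply[OF T])
  also have "\<dots> \<le> norm (abs_op T o\<^sub>L S)" using norm_blinfun[of "abs_op T o\<^sub>L S" x] x by simp
  also have "\<dots> \<le> norm (abs_op T) * sqrt (norm (S o\<^sub>L S))"
    by (rule norm_symmetrized_product_le[OF positive_op_abs_op[OF T] S assms(3) x])
  also have "\<dots> \<le> (?F * ?G) * (1/2 * ?s)"
    using nA FG s by (intro mult_mono) auto
  finally show "cmod (cinner ((T o\<^sub>L S) x) x) \<le> 1/2 * ?s * ?F * ?G" by (simp only: mult_ac)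
qed

end
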